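(* There exists a planar hypohamiltonian graph with exactly $42$ vertices. That is, there exists a planar graph $G$ with $|V(G)| = 42$ such that $G$ is not Hamiltonian, but for every vertex $v \in V(G)$ the graph $G - v$ is Hamiltonian.
   Context: Graphs are finite, simple and undirected. A graph is Hamiltonian if it contains a cycle passing through all of its vertices. For a vertex $v$ of $G$, $G - v$ denotes the graph obtained from $G$ by deleting $v$ and all edges incident to it. A graph is called hypohamiltonian if it is not Hamiltonian but deleting any single vertex gives a Hamiltonian graph. *)

theory Defs
  imports "HOL-Analysis.Path_Connected" "Graph_Theory.Digraph" "Graph_Theory.Arc_Walk"
begin

text \<open>
  Following \<^theory>\<open>Graph_Theory.Digraph\<close>, a finite simple undirected graph is a finite symmetric digraph
  without loops and parallel arcs (locale \<^locale>\<open>graph\<close>): an undirected edge is a pair of opposite arcs.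
\<close>

definition edges :: "('a, 'b) pre_digraph \<Rightarrow> 'a set set" where
  "edges G = (\<lambda>e. {tail G e, head G e}) ` arcs G"

text \<open>
  The library's notion of a cycle admits \<open>u, v, u\<close> in a symmetric digraph. This is not a cycle of an
  undirected graph, hence the bound on the length.
\<close>

definition hamiltonian :: "('a, 'b) pre_digraph \<Rightarrow> bool" where
  "hamiltonian G \<longleftrightarrow>
     (\<exists>p. pre_digraph.cycle G p \<and> length p \<ge> 3 \<and> tail G ` set p = verts G)"

definition hypohamiltonian :: "('a, 'b) pre_digraph \<Rightarrow> bool" where
  "hypohamiltonian G \<longleftrightarrow>
     \<not> hamiltonian G \<and> (\<forall>v \<in> verts G. hamiltonian (pre_digraph.del_vert G v))"

text \<open>
  Drawings in the plane \<^typ>\<open>complex\<close>: \<open>pos\<close> places the vertices and \<open>crv e\<close> is a simple curve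
  joining the ends of the edge \<open>e\<close>. It meets no other vertex, and two different curves meet only
  in common ends.
\<close>

definition plane_drawing ::
  "('a, 'b) pre_digraph \<Rightarrow> ('a \<Rightarrow> complex) \<Rightarrow> ('a set \<Rightarrow> real \<Rightarrow> complex) \<Rightarrow> bool" where
  "plane_drawing G pos crv \<longleftrightarrow>
     inj_on pos (verts G) \<and>
     (\<forall>e \<in> edges G. arc (crv e) \<and> {pathstart (crv e), pathfinish (crv e)} = pos ` e \<and>
        path_image (crv e) \<inter> pos ` verts G = pos ` e) \<and>
     (\<forall>e \<in> edges G. \<forall>f \<in> edges G. e \<noteq> f \<longrightarrow>
        path_image (crv e) \<inter> path_image (crv f) = pos ` (e \<inter> f))"

definition planar :: "('a, 'b) pre_digraph \<Rightarrow> bool" where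
  "planar G \<longleftrightarrow> (\<exists>pos crv. plane_drawing G pos crv)"

end

theory Submission
  imports Defs "HOL-Library.Code_Binary_Nat"
begin

text \<open>
  The graph has a plane embedding with one quadrilateral and 26 pentagons. By Grinberg's theorem the
  faces \<open>f\<close> inside a Hamiltonian cycle would satisfy \<open>\<Sum>(|f| - 2) = 42 - 2\<close>. Modulo 3 the left side
  is 0 or 2 and the right side is 1, so there is no such cycle. Grinberg's theorem is proved without
  the Jordan curve theorem: every even edge set is the boundary of a set of faces, the two sides of
  the cycle are connected in the dual graph, and Euler's formula then makes both of them dual trees.
\<close>

section \<open>Grinberg's criterion for combinatorial maps\<close>

text \<open>The faces in the count are never identified with regions of the drawing. What matters is
  Euler's formula \<open>card_E\<close>, the two trees, and that the boundary of every single face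
  has even degree at every vertex (\<open>face_even\<close>); in a plane embedding this holds
  because such a boundary consists of closed walks. All this is a finite check, independent of the
  coordinates that prove planarity. In both trees parents have smaller numbers than their children,
  so connectedness and acyclicity become inductions on numbers. Of the Hamiltonian cycle the count
  uses only that it has \<open>n\<close> edges and is a minimal nonempty even edge set.\<close>

text \<open>
  A plane graph given by a spanning tree and its dual cotree: the edge \<open>e\<close> joins the vertices \<open>a e\<close>
  and \<open>b e\<close> and separates the faces \<open>l e\<close> and \<open>r e\<close>; \<open>te v\<close> is the tree edge from \<open>v\<close> to its parent,
  \<open>ce f\<close> the dual tree edge from the face \<open>f\<close> to its parent.
\<close>

locale tree_cotree =
  fixes n m :: nat and E :: "'e set" and a b l r :: "'e \<Rightarrow> nat" and te ce :: "nat \<Rightarrow> 'e"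
  assumes E_eq: "E = te ` {1..<n} \<union> ce ` {1..<m}"
    and card_E: "card E + 2 = n + m"
    and ends: "e \<in> E \<Longrightarrow> a e < n \<and> b e < n"
    and sides: "e \<in> E \<Longrightarrow> l e < m \<and> r e < m"
    and te: "v \<in> {1..<n} \<Longrightarrow> a (te v) < v \<and> b (te v) = v"
    and ce: "f \<in> {1..<m} \<Longrightarrow> l (ce f) < f \<and> r (ce f) = f"
    and face_even: "v < n \<Longrightarrow> f < m \<Longrightarrow>
      even (card {e \<in> E. (v = a e \<or> v = b e) \<and> ((l e = f) \<noteq> (r e = f))})"
begin

text \<open>The boundary of a set of faces over GF(2), equivalently a cut of the dual graph: an edge
  with both sides in \<open>S\<close> cancels.\<close>

definition bd :: "nat set \<Rightarrow> 'e set" where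
  "bd S = {e \<in> E. (l e \<in> S) \<noteq> (r e \<in> S)}"

text \<open>Membership in the cycle space over GF(2).\<close>

definition even_set :: "'e set \<Rightarrow> bool" where
  "even_set D \<longleftrightarrow> D \<subseteq> E \<and> (\<forall>v<n. even (card {e \<in> D. v = a e \<or> v = b e}))"

text \<open>Two summands, so that an edge with the same face on both sides counts twice.\<close>

definition face_length :: "nat \<Rightarrow> nat" where
  "face_length f = card {e \<in> E. l e = f} + card {e \<in> E. r e = f}"

lemma finite_E: "finite E"
  by (simp add: E_eq)

lemma even_setD:
  assumes "even_set D"
  shows "D \<subseteq> E" "v < n \<Longrightarrow> even (card {e \<in> D. v = a e \<or> v = b e})"
  using assms unfolding even_set_def by blast+

lemma even_set_sym_diff:
  assumes "even_set A" "even_set B"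
  shows "even_set (sym_diff A B)"
  unfolding even_set_def
proof (intro conjI allI impI)
  show "sym_diff A B \<subseteq> E" using assms[THEN even_setD(1)] by blast
  fix v assume v: "v < n"
  define X where "X = {e \<in> A. v = a e \<or> v = b e}"
  define Y where "Y = {e \<in> B. v = a e \<or> v = b e}"
  have "X \<subseteq> E" "Y \<subseteq> E" unfolding X_def Y_def using assms[THEN even_setD(1)] by blast+
  then have fin: "finite X" "finite Y" using finite_E finite_subset by blast+
  have ev: "even (card X)" "even (card Y)"
    unfolding X_def Y_def using assms[THEN even_setD(2)] v by blast+
  have "card X = card (X - Y) + card (X \<inter> Y)" "card Y = card (Y - X) + card (X \<inter> Y)"
    using card_Diff_subset_Int[of X Y] card_Diff_subset_Int[of Y X] fin
      card_mono[of X "X \<inter> Y"] card_mono[of Y "X \<inter> Y"]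
    by (simp_all add: Int_commute)
  moreover have "card (sym_diff X Y) = card (X - Y) + card (Y - X)"
    using fin by (intro card_Un_disjoint) auto
  ultimately have "even (card (sym_diff X Y))" using ev by presburger
  also have "sym_diff X Y = {e \<in> sym_diff A B. v = a e \<or> v = b e}"
    by (auto simp: X_def Y_def)
  finally show "even (card {e \<in> sym_diff A B. v = a e \<or> v = b e})" .
qed

text \<open>\<open>bd\<close> is additive over GF(2), so single faces suffice, and these are
  \<open>face_even\<close>.\<close>

lemma even_set_bd:
  assumes "S \<subseteq> {..<m}"
  shows "even_set (bd S)"
  using finite_subset[OF assms finite_lessThan] assms
proof (induction S rule: finite_induct)
  case empty
  show ?case by (simp add: even_set_def bd_def)
next
  case (insert f S)
  have "{e \<in> bd {f}. v = a e \<or> v = b e} =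
      {e \<in> E. (v = a e \<or> v = b e) \<and> ((l e = f) \<noteq> (r e = f))}" for v
    by (auto simp: bd_def)
  then have "even_set (bd {f})"
    using face_even insert.prems by (auto simp: even_set_def bd_def)
  moreover have "bd (insert f S) = sym_diff (bd {f}) (bd S)"
    using insert.hyps by (auto simp: bd_def)
  ultimately show ?case using even_set_sym_diff insert by auto
qed

text \<open>Faces are decided in increasing order. The edge \<open>ce k\<close> joins
  \<open>k\<close> to a smaller face that is already decided, so including or omitting
  \<open>k\<close> gives \<open>ce k\<close> the wanted status. Earlier cotree edges have both sides
  below \<open>k\<close> and keep theirs.\<close>

lemma cotree_boundary:
  assumes "k \<le> m"
  shows "\<exists>S\<subseteq>{..<k}. \<forall>f\<in>{1..<k}. ce f \<in> bd S \<longleftrightarrow> ce f \<in> D"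
  using assms
proof (induction k)
  case 0
  then show ?case by auto
next
  case (Suc k)
  then obtain S where S: "S \<subseteq> {..<k}" "\<forall>f\<in>{1..<k}. ce f \<in> bd S \<longleftrightarrow> ce f \<in> D"
    by auto
  define S' where "S' = (if (l (ce k) \<in> S) \<noteq> (ce k \<in> D) then insert k S else S)"
  have "ce f \<in> bd S' \<longleftrightarrow> ce f \<in> D" if f: "f \<in> {1..<Suc k}" for f
  proof (cases "f = k")
    case True
    have "ce k \<in> E" "l (ce k) < k" "r (ce k) = k"
      using f Suc.prems ce[of k] True by (auto simp: E_eq)
    then show ?thesis using S(1) True by (auto simp: S'_def bd_def)
  next
    case False
    then have "f \<in> {1..<k}" using f by auto
    moreover have "l (ce f) < k" "r (ce f) < k"
      using ce[of f] Suc.prems calculation by auto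
    ultimately show ?thesis using S(2) by (auto simp: S'_def bd_def)
  qed
  moreover have "S' \<subseteq> {..<Suc k}" using S(1) by (auto simp: S'_def)
  ultimately show ?case by blast
qed

text \<open>
  Subtracting a boundary leaves a subset of the spanning tree, and a nonempty forest has a leaf.
\<close>

lemma even_set_is_boundary:
  assumes D: "even_set D"
  shows "\<exists>S\<subseteq>{..<m}. bd S = D"
proof -
  obtain S where S: "S \<subseteq> {..<m}" "\<forall>f\<in>{1..<m}. ce f \<in> bd S \<longleftrightarrow> ce f \<in> D"
    using cotree_boundary[of m D] by auto
  define X where "X = sym_diff D (bd S)"
  have X: "even_set X" unfolding X_def by (intro even_set_sym_diff D even_set_bd S(1))
  have ce_X: "ce f \<notin> X" if "f \<in> {1..<m}" for f
    using S(2) that by (auto simp: X_def)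
  \<comment> \<open>Induction downwards in \<open>v\<close>: an edge of \<open>X\<close> at
    \<open>v\<close> other than \<open>te v\<close> would lead to a child \<open>w > v\<close>, and
    \<open>te w\<close> is already excluded. One edge alone contradicts evenness.\<close>
  have te_X: "te v \<notin> X" if "v \<in> {1..<n}" for v
    using that
  proof (induction "n - v" arbitrary: v rule: less_induct)
    case less
    have sub: "{e \<in> X. v = a e \<or> v = b e} \<subseteq> {te v}"
    proof
      fix e assume e: "e \<in> {e \<in> X. v = a e \<or> v = b e}"
      then have "e \<in> E" using even_setD(1)[OF X] by blast
      then obtain w where w: "w \<in> {1..<n}" "e = te w" using e ce_X by (auto simp: E_eq)
      have "\<not> v < w"
      proof
        assume "v < w"
        then have "n - w < n - v" using w(1) by auto
        then show False using less.hyps w e by blast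
      qed
      then show "e \<in> {te v}" using te[OF w(1)] w e by auto
    qed
    show ?case
    proof
      assume "te v \<in> X"
      then have "{e \<in> X. v = a e \<or> v = b e} = {te v}" using sub te[OF less.prems] by auto
      moreover have "even (card {e \<in> X. v = a e \<or> v = b e})"
        using even_setD(2)[OF X] less.prems by simp
      ultimately show False by simp
    qed
  qed
  have "X \<subseteq> E" by (rule even_setD(1)[OF X])
  then have "X = {}" using ce_X te_X unfolding E_eq by blast
  then have "bd S = D" by (auto simp: X_def)
  then show ?thesis using S(1) by blast
qed

text \<open>Membership in \<open>S\<close> cannot change across an edge outside the boundary, and
  the cotree links every face to face 0.\<close>

lemma bd_empty_iff:
  assumes "S \<subseteq> {..<m}" "bd S = {}"
  shows "S = {} \<or> S = {..<m}"
proof -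
  have "f \<in> S \<longleftrightarrow> 0 \<in> S" if "f < m" for f
    using that
  proof (induction f rule: less_induct)
    case (less f)
    show ?case
    proof (cases "f = 0")
      case False
      then have f: "f \<in> {1..<m}" using less.prems by auto
      then have "ce f \<in> E" by (auto simp: E_eq)
      then have "l (ce f) \<in> S \<longleftrightarrow> r (ce f) \<in> S" using assms(2) by (auto simp: bd_def)
      then show ?thesis using ce[OF f] less.IH[of "l (ce f)"] less.prems by simp
    qed simp
  qed
  then show ?thesis using assms(1) by blast
qed

text \<open>
  The faces on one side of \<open>C\<close> are connected in the dual graph without \<open>C\<close>: the boundary of a
  component would be an even proper subset of \<open>C\<close>.
\<close>

lemma card_inner_edges:
  assumes C: "\<And>D. even_set D \<Longrightarrow> D \<subseteq> C \<Longrightarrow> D = {} \<or> D = C"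
    and S: "S \<subseteq> {..<m}" "bd S = C"
  shows "card S \<le> Suc (card {e \<in> E. l e \<in> S \<and> r e \<in> S})"
proof (cases "S = {}")
  case False
  define I where "I T = {e \<in> E. l e \<in> T \<and> r e \<in> T}" for T
  have finS: "finite S" using S(1) finite_subset by blast
  have crossing: "\<exists>e\<in>I S. (l e \<in> T) \<noteq> (r e \<in> T)" if T: "T \<subseteq> S" "T \<noteq> {}" "T \<noteq> S" for T
  proof (rule ccontr)
    assume "\<not> ?thesis"
    then have *: "bd T \<subseteq> C" using T S(2) by (auto simp: bd_def I_def)
    have "T \<subseteq> {..<m}" "S - T \<subseteq> {..<m}" using T S(1) by auto
    moreover from this have "bd T = {} \<or> bd T = C" using C[OF even_set_bd *] by auto
    \<comment> \<open>For \<open>T\<close> inside \<open>S\<close>, the boundary of the difference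
      is the symmetric difference of the boundaries. So \<open>T\<close> or \<open>S - T\<close> has
      an empty boundary.\<close>
    moreover have "bd (S - T) = {}" if "bd T = C"
      using that S(2) T(1) by (auto simp: bd_def set_eq_iff)
    ultimately show False using bd_empty_iff[of T] bd_empty_iff[of "S - T"] T S(1) by blast
  qed
  \<comment> \<open>A spanning tree of the dual graph on \<open>S\<close> is grown face by face;
    each new face brings an inner edge that was not inner before.\<close>
  have "\<exists>T\<subseteq>S. card T = Suc k \<and> k \<le> card (I T)" if "Suc k \<le> card S" for k
    using that
  proof (induction k)
    case 0
    obtain x where "x \<in> S" using False by blast
    then show ?case by (intro exI[of _ "{x}"]) auto
  next
    case (Suc k)
    then obtain T where T: "T \<subseteq> S" "card T = Suc k" "k \<le> card (I T)" by auto
    have "T \<noteq> {}" "T \<noteq> S" using T Suc.prems by auto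
    then obtain e where e: "e \<in> I S" "(l e \<in> T) \<noteq> (r e \<in> T)" using crossing T(1) by blast
    define T' where "T' = T \<union> {l e, r e}"
    have "finite T" using T(1) finS finite_subset by blast
    then have "card T' = Suc (Suc k)" using T(2) e(2)
      by (cases "l e \<in> T") (auto simp: T'_def insert_absorb)
    moreover have "insert e (I T) \<subseteq> I T'" "e \<notin> I T" using e by (auto simp: I_def T'_def)
    then have "Suc k \<le> card (I T')"
      using T(3) card_mono[of "I T'" "insert e (I T)"] finite_E by (auto simp: I_def)
    moreover have "T' \<subseteq> S" using T(1) e(1) by (auto simp: T'_def I_def)
    ultimately show ?case by blast
  qed
  moreover obtain k where k: "card S = Suc k"
    using False finS by (cases "card S") auto
  ultimately obtain T where T: "T \<subseteq> S" "card T = card S" "k \<le> card (I T)" by auto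
  then have "T = S" by (intro card_subset_eq finS)
  then have "k \<le> card (I S)" using T(3) by simp
  then show ?thesis by (simp add: k I_def)
qed simp

text \<open>\<open>C\<close> bounds a side \<open>S\<close> and its complement \<open>S'\<close>.
  Its \<open>n\<close> edges leave \<open>m - 2\<close> others, while the sides need at least
  \<open>card S - 1\<close> and \<open>card S' - 1\<close> inner edges, which sum to
  \<open>m - 2\<close>; so equality holds on both sides. Summing face lengths over \<open>S\<close>
  counts inner edges twice and edges of \<open>C\<close> once, giving
  \<open>2 * (card S - 1) + n\<close>.\<close>

theorem grinberg:
  assumes C: "even_set C" "card C = n" "\<And>D. even_set D \<Longrightarrow> D \<subseteq> C \<Longrightarrow> D = {} \<or> D = C"
  shows "\<exists>S\<subseteq>{..<m}. (\<Sum>f\<in>S. int (face_length f) - 2) = int n - 2"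
proof -
  obtain S where S: "S \<subseteq> {..<m}" "bd S = C" using even_set_is_boundary[OF C(1)] by blast
  define I where "I T = {e \<in> E. l e \<in> T \<and> r e \<in> T}" for T
  define S' where "S' = {..<m} - S"
  have S': "S' \<subseteq> {..<m}" "bd S' = C"
    using S sides by (auto simp: bd_def S'_def)
  have le: "card S \<le> Suc (card (I S))" "card S' \<le> Suc (card (I S'))"
    using card_inner_edges[OF C(3) S] card_inner_edges[OF C(3) S'] by (auto simp: I_def)
  have finS: "finite S" using S(1) finite_subset by blast
  have "m = card (S \<union> S')" using S(1) by (simp add: S'_def Un_absorb1)
  also have "\<dots> = card S + card S'" using finS by (intro card_Un_disjoint) (auto simp: S'_def)
  finally have m: "m = card S + card S'" .
  have "E = I S \<union> I S' \<union> bd S" using sides by (auto simp: I_def bd_def S'_def)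
  then have "card E = card (I S \<union> I S' \<union> bd S)" by simp
  also have "\<dots> = card (I S) + card (I S') + card (bd S)"
  proof -
    have "finite (I S)" "finite (I S')" "finite (bd S)"
      using finite_E by (auto simp: I_def bd_def)
    moreover have "I S \<inter> I S' = {}" "(I S \<union> I S') \<inter> bd S = {}"
      by (auto simp: I_def bd_def S'_def)
    ultimately show ?thesis by (simp add: card_Un_disjoint)
  qed
  finally have inner: "card S = Suc (card (I S))"
    using le m card_E C(2) unfolding S(2) by linarith
  have count: "(\<Sum>f\<in>S. card {e \<in> E. g e = f}) = card {e \<in> E. g e \<in> S}" for g :: "'e \<Rightarrow> nat"
  proof -
    have "{e \<in> E. g e \<in> S} = (\<Union>f\<in>S. {e \<in> E. g e = f})" by auto
    moreover have "card (\<Union>f\<in>S. {e \<in> E. g e = f}) = (\<Sum>f\<in>S. card {e \<in> E. g e = f})"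
      using finS finite_E by (intro card_UN_disjoint) auto
    ultimately show ?thesis by simp
  qed
  have "card {e \<in> E. l e \<in> S} + card {e \<in> E. r e \<in> S} =
      card ({e \<in> E. l e \<in> S} \<union> {e \<in> E. r e \<in> S}) + card ({e \<in> E. l e \<in> S} \<inter> {e \<in> E. r e \<in> S})"
    using finite_E by (intro card_Un_Int) auto
  also have "{e \<in> E. l e \<in> S} \<inter> {e \<in> E. r e \<in> S} = I S" by (auto simp: I_def)
  also have "{e \<in> E. l e \<in> S} \<union> {e \<in> E. r e \<in> S} = I S \<union> bd S" by (auto simp: I_def bd_def)
  also have "card (I S \<union> bd S) = card (I S) + card (bd S)"
    using finite_E by (intro card_Un_disjoint) (auto simp: I_def bd_def)
  finally have "(\<Sum>f\<in>S. face_length f) = 2 * card (I S) + n"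
    using C(2) S(2) by (simp add: face_length_def sum.distrib count)
  from arg_cong[OF this, of int]
  have "(\<Sum>f\<in>S. int (face_length f)) = 2 * int (card (I S)) + int n"
    by simp
  then have "(\<Sum>f\<in>S. int (face_length f) - 2) = int n - 2"
    using inner by (simp add: sum_subtractf)
  then show ?thesis using S(1) by blast
qed

text \<open>At every vertex exactly two cycle edges meet, and they are consecutive. An even subset
  of the cycle contains both or neither, and this propagates around the cycle, which gives
  minimality.\<close>

lemma grinberg_hamiltonian:
  assumes n: "n \<ge> 3" and w: "bij_betw w {..<n} {..<n}"
    and c: "\<And>i. i < n \<Longrightarrow> c i \<in> E \<and> {a (c i), b (c i)} = {w i, w (Suc i mod n)}"
  shows "\<exists>S\<subseteq>{..<m}. (\<Sum>f\<in>S. int (face_length f) - 2) = int n - 2"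
proof (rule grinberg)
  define s where "s i = Suc i mod n" for i
  have s: "s i < n" "s i \<noteq> i" "s (s i) \<noteq> i" if "i < n" for i
    using that n by (auto simp: s_def mod_Suc split: if_splits)
  have s_inj: "s i = s j \<longleftrightarrow> i = j" if "i < n" "j < n" for i j
    using that by (auto simp: s_def mod_Suc split: if_splits)
  have w_inj: "w i = w j \<longleftrightarrow> i = j" if "i < n" "j < n" for i j
    using w that by (auto simp: bij_betw_def inj_on_def)
  have inc: "(w j = a (c i) \<or> w j = b (c i)) \<longleftrightarrow> j = i \<or> j = s i" if "i < n" "j < n" for i j
  proof -
    have "(w j = a (c i) \<or> w j = b (c i)) \<longleftrightarrow> w j \<in> {w i, w (s i)}"
      using c[OF that(1)] unfolding s_def by blast
    then show ?thesis using w_inj s that by auto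
  qed
  \<comment> \<open>If two positions carried the same edge, each would be the successor of the
    other; \<open>s (s i) \<noteq> i\<close> rules this out and rests on
    \<open>n \<ge> 3\<close>.\<close>
  have c_inj: "i = j" if "c i = c j" "i < n" "j < n" for i j
  proof -
    have "j = i \<or> j = s i" using inc[OF that(2,3)] inc[OF that(3,3)] unfolding that(1) by blast
    moreover have "i = j \<or> i = s j"
      using inc[OF that(3,2)] inc[OF that(2,2)] unfolding that(1) by blast
    ultimately show ?thesis using s(3)[OF that(2)] by metis
  qed
  then have inj: "inj_on c {..<n}" by (auto simp: inj_on_def)
  have c_eq: "c i = c j \<longleftrightarrow> i = j" if "i < n" "j < n" for i j
    using c_inj that by blast
  let ?C = "c ` {..<n}"
  show "card ?C = n" using inj by (simp add: card_image)
  have at: "\<exists>i<n. \<forall>e\<in>?C. (v = a e \<or> v = b e) \<longleftrightarrow> e = c i \<or> e = c (s i)" if "v < n" for v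
  proof -
    have "v \<in> w ` {..<n}" using w that by (simp add: bij_betw_def)
    then obtain j where j: "j < n" "v = w j" by blast
    \<comment> \<open>The cyclic predecessor of \<open>j\<close>: the edges at \<open>w j\<close>
      are \<open>c i\<close> and \<open>c j = c (s i)\<close>.\<close>
    define i where "i = (if j = 0 then n - 1 else j - 1)"
    have i: "i < n" "j = s i" using j n by (auto simp: i_def s_def mod_Suc)
    have "(v = a (c k) \<or> v = b (c k)) \<longleftrightarrow> c k = c i \<or> c k = c (s i)" if "k < n" for k
      using inc[OF that j(1)] s_inj[OF i(1) that] c_eq[OF that i(1)]
        c_eq[OF that s(1)[OF i(1)]] i(2) j(2) by auto
    then have "\<forall>e\<in>?C. (v = a e \<or> v = b e) \<longleftrightarrow> e = c i \<or> e = c (s i)" by simp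
    with i(1) show ?thesis by (intro exI[of _ i] conjI)
  qed
  have sub: "?C \<subseteq> E" using c by auto
  show "even_set ?C"
    unfolding even_set_def
  proof (intro conjI allI impI sub)
    fix v assume "v < n"
    then obtain i where i: "i < n" "\<forall>e\<in>?C. (v = a e \<or> v = b e) \<longleftrightarrow> e = c i \<or> e = c (s i)"
      using at by blast
    then have "{e \<in> ?C. v = a e \<or> v = b e} = {c i, c (s i)}" using s by auto
    moreover have "c i \<noteq> c (s i)" using c_eq[OF i(1) s(1)] s(2) i(1) by force
    ultimately show "even (card {e \<in> ?C. v = a e \<or> v = b e})" by simp
  qed
  fix D assume D: "even_set D" "D \<subseteq> ?C"
  have step: "c i \<in> D \<longleftrightarrow> c (s i) \<in> D" if "i < n" for i
  proof -
    have "w (s i) < n" using w s that by (auto simp: bij_betw_def)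
    then have ev: "even (card {e \<in> D. w (s i) = a e \<or> w (s i) = b e})"
      by (rule even_setD(2)[OF D(1)])
    have "(w (s i) = a (c k) \<or> w (s i) = b (c k)) \<longleftrightarrow> c k = c i \<or> c k = c (s i)" if "k < n" for k
      using inc[OF that s(1)[OF \<open>i < n\<close>]] s_inj[OF \<open>i < n\<close> that] c_eq[OF that \<open>i < n\<close>]
        c_eq[OF that s(1)[OF \<open>i < n\<close>]] by auto
    then have *: "\<forall>e\<in>?C. (w (s i) = a e \<or> w (s i) = b e) \<longleftrightarrow> e = c i \<or> e = c (s i)" by simp
    have "{e \<in> D. w (s i) = a e \<or> w (s i) = b e} = {e \<in> D. e = c i \<or> e = c (s i)}"
      by (intro Collect_cong conj_cong refl) (rule bspec[OF * subsetD[OF D(2)]])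
    also have "\<dots> = D \<inter> {c i, c (s i)}" by auto
    finally have "{e \<in> D. w (s i) = a e \<or> w (s i) = b e} = D \<inter> {c i, c (s i)}" .
    moreover have "c i \<noteq> c (s i)" using c_eq[OF that s(1)] s(2) that by force
    ultimately show ?thesis using ev by (auto simp: Int_insert_right split: if_splits)
  qed
  have "c i \<in> D \<longleftrightarrow> c 0 \<in> D" if "i < n" for i
    using that
  proof (induction i)
    case (Suc i)
    then show ?case using step[of i] by (simp add: s_def)
  qed simp
  then show "D = {} \<or> D = ?C" using D(2) by blast
qed

end

section \<open>Hamiltonian cycles as vertex lists\<close>

lemma map_head_cas:
  assumes "pre_digraph.cas G u p v" "p \<noteq> []"
  shows "map (head G) p = tl (map (tail G) p) @ [v]" "tail G (hd p) = u"
proof -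
  have "map (head G) p = tl (map (tail G) p) @ [v] \<and> tail G (hd p) = u"
    using assms
  proof (induction p arbitrary: u)
    case (Cons x p)
    then show ?case by (cases p) (auto simp: pre_digraph.cas.simps)
  qed simp
  then show "map (head G) p = tl (map (tail G) p) @ [v]" "tail G (hd p) = u" by auto
qed

text \<open>In a closed walk the list of heads is the list of tails rotated by one. Hence
  distinctness of \<open>tl (awalk_verts ...)\<close>, which lists the heads, carries over to the
  tails.\<close>

lemma hamiltonianE:
  assumes "hamiltonian G"
  obtains p where "set p \<subseteq> arcs G" "length p \<ge> 3" "distinct (map (tail G) p)"
    "tail G ` set p = verts G" "\<forall>i<length p. head G (p ! i) = tail G (p ! (Suc i mod length p))"
proof -
  obtain p u where p: "pre_digraph.awalk G u p u" "distinct (tl (pre_digraph.awalk_verts G u p))"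
      "length p \<ge> 3" "tail G ` set p = verts G"
    using assms unfolding hamiltonian_def pre_digraph.cycle_def by blast
  have ne: "p \<noteq> []" using p(3) by auto
  have cas: "pre_digraph.cas G u p u" and sub: "set p \<subseteq> arcs G"
    using p(1) by (auto simp: pre_digraph.awalk_def)
  have rot: "map (head G) p = rotate1 (map (tail G) p)"
    using map_head_cas[OF cas ne] ne by (cases p) auto
  have "distinct (map (head G) p)"
    using p(2) ne by (simp add: pre_digraph.awalk_verts_conv'[OF cas])
  then have dist: "distinct (map (tail G) p)" using rot by simp
  have "head G (p ! i) = tail G (p ! (Suc i mod length p))" if "i < length p" for i
  proof -
    have "head G (p ! i) = rotate1 (map (tail G) p) ! i" using that rot by (metis nth_map)
    also have "\<dots> = map (tail G) p ! (Suc i mod length p)" using that by (simp add: nth_rotate1)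
    also have "\<dots> = tail G (p ! (Suc i mod length p))"
      using that by (intro nth_map mod_less_divisor) auto
    finally show ?thesis .
  qed
  then show ?thesis using that sub p dist by blast
qed

lemma hamiltonian_pairI:
  assumes G: "tail G = fst" "head G = snd"
    and xs: "distinct xs" "length xs \<ge> 3" "set xs = verts G" "set (zip xs (rotate1 xs)) \<subseteq> arcs G"
  shows "hamiltonian G"
proof -
  define p where "p = zip xs (rotate1 xs)"
  have tails: "map (tail G) p = xs" and heads: "map (head G) p = rotate1 xs"
    by (simp_all add: p_def G)
  obtain x ys where x: "xs = x # ys" using xs(2) by (cases xs) auto
  have cas: "pre_digraph.cas G u (zip (u # zs) (zs @ [v])) v" for u v zs
    by (induction zs arbitrary: u) (auto simp: pre_digraph.cas.simps G)
  have "pre_digraph.awalk G x p x"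
    unfolding pre_digraph.awalk_def using xs x cas[of x ys x] by (auto simp: p_def)
  moreover from this have "tl (pre_digraph.awalk_verts G x p) = map (head G) p"
    using x by (subst pre_digraph.awalk_verts_conv') (auto simp: p_def pre_digraph.awalk_def)
  then have "distinct (tl (pre_digraph.awalk_verts G x p))" using heads xs(1) by simp
  moreover have "tail G ` set p = verts G" using tails xs(3) by (metis list.set_map)
  moreover have "length p \<ge> 3" using xs(2) by (simp add: p_def)
  moreover from this have "p \<noteq> []" by auto
  ultimately show ?thesis
    unfolding hamiltonian_def pre_digraph.cycle_def by blast
qed

section \<open>Straight-line drawings with integer coordinates\<close>

text \<open>Twice the signed area of the triangle \<open>p\<close>, \<open>q\<close>,
  \<open>x\<close>; the sign tells on which side of the line \<open>pq\<close> the point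
  \<open>x\<close> lies.\<close>

definition orient :: "int \<times> int \<Rightarrow> int \<times> int \<Rightarrow> int \<times> int \<Rightarrow> int" where
  "orient p q x = (fst q - fst p) * (snd x - snd p) - (snd q - snd p) * (fst x - fst p)"

definition cpt :: "int \<times> int \<Rightarrow> complex" where
  "cpt p = Complex (of_int (fst p)) (of_int (snd p))"

text \<open>The line through one segment has the other on one side, touching it at most in common
  ends. If this fails for both orders because both segments straddle strictly, they cross; so,
  collinear cases aside, testing both orders loses nothing.\<close>

fun one_sided :: "(int \<times> int) \<times> (int \<times> int) \<Rightarrow> (int \<times> int) \<times> (int \<times> int) \<Rightarrow> bool" where
  "one_sided (p, q) (x, y) =
     (let s = orient p q x; t = orient p q y
      in 0 \<le> s * t \<and> (s = 0 \<longrightarrow> x = p \<or> x = q) \<and> (t = 0 \<longrightarrow> y = p \<or> y = q))"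

lemma inj_cpt: "inj cpt"
  by (auto simp: inj_def cpt_def prod_eq_iff)

text \<open>The affine function \<open>h\<close> vanishes on the line \<open>pq\<close> and has
  values \<open>u\<close>, \<open>v\<close> of no opposite signs at \<open>x\<close>,
  \<open>y\<close>. A zero on the segment \<open>xy\<close> is therefore an end of it, or
  \<open>u = v = 0\<close>, which forces \<open>{x, y} = {p, q}\<close>.\<close>

lemma segment_inter_one_sided:
  assumes side: "one_sided (p, q) (x, y)" and xy: "x \<noteq> y" "{p, q} \<noteq> {x, y}"
  shows "closed_segment (cpt p) (cpt q) \<inter> closed_segment (cpt x) (cpt y) \<subseteq> cpt ` ({p, q} \<inter> {x, y})"
proof
  define h where "h z = (Re (cpt q) - Re (cpt p)) * (Im z - Im (cpt p))
      - (Im (cpt q) - Im (cpt p)) * (Re z - Re (cpt p))" for z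
  have aff: "h ((1 - t) *\<^sub>R z + t *\<^sub>R z') = (1 - t) * h z + t * h z'" for t z z'
    by (simp add: h_def algebra_simps)
  have h_cpt: "h (cpt z) = of_int (orient p q z)" for z
    by (simp add: h_def cpt_def orient_def)
  fix z assume z: "z \<in> closed_segment (cpt p) (cpt q) \<inter> closed_segment (cpt x) (cpt y)"
  have "h (cpt p) = 0" "h (cpt q) = 0" by (simp_all add: h_def algebra_simps)
  moreover obtain t' where "z = (1 - t') *\<^sub>R cpt p + t' *\<^sub>R cpt q"
    using z by (auto simp: closed_segment_def)
  ultimately have hz: "h z = 0" using aff by simp
  obtain t where t: "0 \<le> t" "t \<le> 1" "z = (1 - t) *\<^sub>R cpt x + t *\<^sub>R cpt y"
    using z by (auto simp: closed_segment_def)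
  define u v :: real where "u = of_int (orient p q x)" and "v = of_int (orient p q y)"
  have "0 \<le> orient p q x * orient p q y" using side by (simp add: Let_def)
  then have uv: "0 \<le> u * v" unfolding u_def v_def by (metis of_int_0_le_iff of_int_mult)
  have eq: "(1 - t) * u + t * v = 0" using hz t(3) aff h_cpt by (simp add: u_def v_def)
  \<comment> \<open>Multiplying by \<open>u\<close> and by \<open>v\<close> makes every summand
    nonnegative, so each one vanishes.\<close>
  have sq: "(1 - t) * u\<^sup>2 + t * (u * v) = 0" "(1 - t) * (u * v) + t * v\<^sup>2 = 0"
    using arg_cong[OF eq, of "\<lambda>s. s * u"] arg_cong[OF eq, of "\<lambda>s. s * v"]
    by (simp_all add: algebra_simps power2_eq_square)
  have "t = 1 \<or> u = 0"
    using sq(1) uv t by (smt (verit) mult_nonneg_nonneg mult_eq_0_iff zero_le_power2 power_eq_0_iff)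
  moreover have "t = 0 \<or> v = 0"
    using sq(2) uv t by (smt (verit) mult_nonneg_nonneg mult_eq_0_iff zero_le_power2 power_eq_0_iff)
  moreover have "u = 0 \<longrightarrow> x = p \<or> x = q" "v = 0 \<longrightarrow> y = p \<or> y = q"
    using side by (auto simp: Let_def u_def v_def)
  moreover have "z = cpt y" if "t = 1" using that t(3) by simp
  moreover have "z = cpt x" if "t = 0" using that t(3) by simp
  ultimately show "z \<in> cpt ` ({p, q} \<inter> {x, y})" using xy by auto
qed

declare one_sided.simps [simp del]

lemma segment_inter:
  assumes "one_sided (p, q) (x, y) \<or> one_sided (x, y) (p, q)" "x \<noteq> y" "p \<noteq> q" "{p, q} \<noteq> {x, y}"
  shows "closed_segment (cpt p) (cpt q) \<inter> closed_segment (cpt x) (cpt y) = cpt ` ({p, q} \<inter> {x, y})"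
  using assms segment_inter_one_sided[of p q x y] segment_inter_one_sided[of x y p q]
  by (auto simp: Int_commute)

text \<open>Comparing pairs of edges is enough: by \<open>covered\<close> a vertex on a foreign
  segment is an end of some other edge, and two segments meet only in common ends.\<close>

lemma planar_straight_line:
  fixes G :: "(nat, 'b) pre_digraph" and pt :: "nat \<Rightarrow> int \<times> int"
  assumes edges: "edges G = (\<lambda>(u, v). {u, v}) ` A"
    and A: "\<And>u v. (u, v) \<in> A \<Longrightarrow> u < v \<and> u \<in> verts G \<and> v \<in> verts G"
    and covered: "verts G \<subseteq> \<Union> (edges G)"
    and inj: "inj_on pt (verts G)"
    and cross: "\<And>u v x y. (u, v) \<in> A \<Longrightarrow> (x, y) \<in> A \<Longrightarrow> (u, v) \<noteq> (x, y) \<Longrightarrow>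
      one_sided (pt u, pt v) (pt x, pt y) \<or> one_sided (pt x, pt y) (pt u, pt v)"
  shows "planar G"
proof -
  define pos where "pos v = cpt (pt v)" for v
  \<comment> \<open>A curve is indexed by an unordered edge; \<open>Min\<close> and
    \<open>Max\<close> recover the order \<open>u < v\<close> of the pairs in
    \<open>A\<close>.\<close>
  define crv where "crv e = linepath (pos (Min e)) (pos (Max e))" for e
  have pos_inj: "pos u = pos v \<longleftrightarrow> u = v" if "u \<in> verts G" "v \<in> verts G" for u v
    using that inj inj_cpt unfolding pos_def by (metis inj_onD injD)
  have crv: "crv {u, v} = linepath (pos u) (pos v)" if "(u, v) \<in> A" for u v
    using A[OF that] by (simp add: crv_def)
  have meet: "path_image (crv {u, v}) \<inter> path_image (crv {x, y}) = pos ` ({u, v} \<inter> {x, y})"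
    if e: "(u, v) \<in> A" "(x, y) \<in> A" "(u, v) \<noteq> (x, y)" for u v x y
  proof -
    have v: "u \<in> verts G" "v \<in> verts G" "x \<in> verts G" "y \<in> verts G" "u < v" "x < y"
      using A e by blast+
    have pt_eq: "pt i = pt j \<longleftrightarrow> i = j" if "i \<in> verts G" "j \<in> verts G" for i j
      using inj that by (auto dest: inj_onD)
    have "{pt u, pt v} \<noteq> {pt x, pt y}" "pt u \<noteq> pt v" "pt x \<noteq> pt y"
      using v e(3) by (auto simp: doubleton_eq_iff pt_eq)
    then have "closed_segment (pos u) (pos v) \<inter> closed_segment (pos x) (pos y)
        = cpt ` ({pt u, pt v} \<inter> {pt x, pt y})"
      unfolding pos_def using cross[OF e] by (intro segment_inter) auto
    also have "{pt u, pt v} \<inter> {pt x, pt y} = pt ` ({u, v} \<inter> {x, y})"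
      using v by (auto simp: pt_eq)
    finally show ?thesis using e crv by (simp add: pos_def image_image)
  qed
  have "path_image (crv e) \<inter> pos ` verts G = pos ` e" if e: "e \<in> edges G" for e
  proof -
    obtain u v where uv: "e = {u, v}" "(u, v) \<in> A" using e edges by auto
    have "w \<in> e" if w: "w \<in> verts G" "pos w \<in> path_image (crv e)" for w
    proof (rule ccontr)
      assume "w \<notin> e"
      obtain x y where xy: "(x, y) \<in> A" "w \<in> {x, y}" using w(1) covered edges by auto
      then have "(u, v) \<noteq> (x, y)" using uv(1) \<open>w \<notin> e\<close> by auto
      moreover have "pos w \<in> path_image (crv {x, y})" using crv[OF xy(1)] xy(2) by auto
      ultimately have "pos w \<in> pos ` ({u, v} \<inter> {x, y})"
        using meet[OF uv(2) xy(1)] w(2) uv(1) by blast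
      then show False using \<open>w \<notin> e\<close> uv w(1) A[OF uv(2)] pos_inj by auto
    qed
    then show ?thesis using uv crv A[OF uv(2)] by auto
  qed
  moreover have "inj_on pos (verts G)" using pos_inj by (auto simp: inj_on_def)
  moreover have "arc (crv e) \<and> {pathstart (crv e), pathfinish (crv e)} = pos ` e"
    if "e \<in> edges G" for e
    using that edges crv A pos_inj by (fastforce intro: arc_linepath)
  moreover have "path_image (crv e) \<inter> path_image (crv f) = pos ` (e \<inter> f)"
    if ef: "e \<in> edges G" "f \<in> edges G" "e \<noteq> f" for e f
  proof -
    obtain u v x y where "e = {u, v}" "(u, v) \<in> A" "f = {x, y}" "(x, y) \<in> A"
      using ef(1,2) edges by auto
    then show ?thesis using meet ef(3) by blast
  qed
  ultimately show ?thesis unfolding planar_def plane_drawing_def by blast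
qed

section \<open>The graph\<close>

text \<open>
  The vertices are numbered along a Hamiltonian path. The entry \<open>i\<close> of \<open>path_sides\<close> lists the
  two faces at the path edge from \<open>i\<close> to \<open>i + 1\<close>. The remaining edges form a spanning tree of the
  dual graph, and the entry \<open>i\<close> of \<open>chords\<close> is \<open>(u, v, g)\<close> for the edge \<open>{u, v}\<close> between the face
  \<open>i + 1\<close> and its parent \<open>g\<close>. Face 0 is a quadrilateral and the other 26 faces are pentagons.
\<close>

definition path_sides :: "(nat \<times> nat) list" where
  "path_sides = [
    (0,6), (4,6), (6,7), (6,9), (3,9), (3,11), (3,13), (1,13), (1,15), (1,17), (0,19), (2,21),
    (2,23), (5,23), (5,24), (8,24), (10,25), (10,26), (12,26), (16,26), (18,26), (20,25),
    (22,25), (22,24), (22,23), (21,22), (20,21), (19,20), (18,19), (17,18), (16,17), (15,16),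
    (14,15), (13,14), (11,14), (11,12), (9,12), (7,10), (7,8), (4,8), (4,5)]"

definition chords :: "(nat \<times> nat \<times> nat) list" where
  "chords = [
    (0,10,0), (1,11,0), (0,7,1), (1,41,2), (13,41,2), (0,4,3), (2,39,4), (15,40,5), (3,37,7),
    (16,38,8), (5,36,9), (18,37,10), (6,34,11), (19,35,12), (8,33,13), (19,32,14), (9,31,15),
    (20,30,16), (10,29,17), (21,28,18), (11,27,19), (22,26,20), (12,25,21), (14,24,23),
    (16,23,24), (17,21,25)]"

text \<open>Entries are \<open>(a, b, l, r)\<close>. The order puts the tree edge of vertex
  \<open>v\<close> at index \<open>v - 1\<close> and the cotree edge of face \<open>f\<close> at
  index \<open>40 + f\<close>. In a chord the parent face comes first, as
  \<open>l (ce f) < f\<close> requires.\<close>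

definition map_edges :: "(nat \<times> nat \<times> nat \<times> nat) list" where
  "map_edges =
     map (\<lambda>(i, f, g). (i, Suc i, f, g)) (List.enumerate 0 path_sides) @
     map (\<lambda>(f, u, v, g). (u, v, g, f)) (List.enumerate 1 chords)"

definition end_pairs :: "(nat \<times> nat) list" where
  "end_pairs = map (\<lambda>(u, v, f, g). (u, v)) map_edges"

definition G42 :: "(nat, nat \<times> nat) pre_digraph" where
  "G42 = \<lparr>verts = {..<42}, arcs = set end_pairs \<union> prod.swap ` set end_pairs,
     tail = fst, head = snd\<rparr>"

text \<open>Integer coordinates make the orientation tests exact. The outer region is the pentagon
  1, 2, 39, 40, 41, which is face 4.\<close>

definition points :: "(int \<times> int) list" where
  "points = [
    (40,30), (43,43), (43,0), (38,4), (40,10), (35,10), (36,16), (37,21), (34,26), (33,32),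
    (36,37), (24,40), (13,39), (6,39), (5,33), (4,23), (5,12), (11,11), (17,9), (21,14),
    (20,20), (15,17), (13,24), (9,19), (9,28), (11,34), (15,29), (18,35), (21,30), (27,34),
    (23,25), (29,27), (26,19), (31,21), (30,15), (25,11), (30,8), (23,4), (7,5), (0,0), (0,28),
    (1,43)]"

text \<open>The entry \<open>v\<close> is a Hamiltonian cycle of the graph without the vertex \<open>v\<close>.\<close>

definition cycles :: "nat list list" where
  "cycles = [
    [1, 2, 3, 4, 5, 6, 7, 8, 9, 10, 11, 12, 13, 14, 15, 16, 17, 18, 19, 20, 21, 22, 23, 24, 25,
    26, 27, 28, 29, 30, 31, 32, 33, 34, 35, 36, 37, 38, 39, 40, 41],
    [0, 4, 3, 2, 39, 38, 37, 18, 19, 20, 21, 17, 16, 23, 22, 26, 25, 24, 14, 15, 40, 41, 13,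
    12, 11, 27, 28, 29, 30, 31, 32, 33, 34, 35, 36, 5, 6, 7, 8, 9, 10],
    [0, 4, 3, 37, 18, 17, 21, 20, 19, 32, 31, 30, 29, 28, 27, 26, 22, 23, 24, 25, 12, 13, 14,
    15, 16, 38, 39, 40, 41, 1, 11, 10, 9, 8, 33, 34, 35, 36, 5, 6, 7],
    [0, 4, 5, 6, 7, 8, 9, 31, 32, 33, 34, 35, 36, 37, 38, 16, 15, 14, 24, 23, 22, 21, 17, 18,
    19, 20, 30, 29, 28, 27, 26, 25, 12, 13, 41, 40, 39, 2, 1, 11, 10],
    [0, 7, 6, 5, 36, 35, 34, 33, 8, 9, 31, 32, 19, 18, 17, 16, 15, 14, 24, 23, 22, 21, 20, 30,
    29, 28, 27, 26, 25, 12, 13, 41, 40, 39, 38, 37, 3, 2, 1, 11, 10],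
    [0, 1, 11, 10, 9, 8, 7, 6, 34, 33, 32, 31, 30, 29, 28, 27, 26, 25, 12, 13, 41, 40, 15, 14,
    24, 23, 22, 21, 20, 19, 35, 36, 37, 18, 17, 16, 38, 39, 2, 3, 4],
    [0, 7, 8, 9, 31, 30, 29, 28, 27, 26, 25, 12, 13, 41, 40, 39, 38, 37, 18, 17, 16, 15, 14,
    24, 23, 22, 21, 20, 19, 32, 33, 34, 35, 36, 5, 4, 3, 2, 1, 11, 10],
    [0, 1, 11, 10, 9, 8, 33, 32, 31, 30, 29, 28, 27, 26, 25, 12, 13, 41, 40, 15, 14, 24, 23,
    22, 21, 20, 19, 18, 17, 16, 38, 39, 2, 3, 37, 36, 35, 34, 6, 5, 4],
    [0, 1, 11, 10, 9, 31, 32, 33, 34, 35, 36, 37, 38, 16, 15, 14, 24, 23, 22, 21, 17, 18, 19,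
    20, 30, 29, 28, 27, 26, 25, 12, 13, 41, 40, 39, 2, 3, 4, 5, 6, 7],
    [0, 4, 5, 6, 34, 35, 36, 37, 3, 2, 1, 11, 10, 29, 28, 27, 26, 25, 12, 13, 41, 40, 39, 38,
    16, 15, 14, 24, 23, 22, 21, 17, 18, 19, 20, 30, 31, 32, 33, 8, 7],
    [0, 1, 11, 12, 25, 24, 23, 22, 26, 27, 28, 29, 30, 20, 21, 17, 18, 19, 35, 36, 37, 38, 16,
    15, 14, 13, 41, 40, 39, 2, 3, 4, 5, 6, 34, 33, 32, 31, 9, 8, 7],
    [0, 1, 41, 13, 12, 25, 26, 27, 28, 29, 10, 9, 8, 7, 6, 5, 36, 35, 34, 33, 32, 31, 30, 20,
    19, 18, 37, 38, 16, 17, 21, 22, 23, 24, 14, 15, 40, 39, 2, 3, 4],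
    [0, 1, 41, 13, 14, 15, 40, 39, 2, 3, 4, 5, 6, 7, 8, 9, 31, 32, 33, 34, 35, 36, 37, 38, 16,
    17, 18, 19, 20, 30, 29, 28, 21, 22, 23, 24, 25, 26, 27, 11, 10],
    [0, 1, 41, 40, 39, 2, 3, 4, 5, 6, 7, 8, 9, 31, 32, 33, 34, 35, 36, 37, 38, 16, 15, 14, 24,
    23, 22, 21, 17, 18, 19, 20, 30, 29, 28, 27, 26, 25, 12, 11, 10],
    [0, 4, 3, 2, 39, 40, 15, 16, 38, 37, 18, 17, 21, 20, 19, 32, 33, 34, 35, 36, 5, 6, 7, 8, 9,
    31, 30, 29, 28, 27, 26, 22, 23, 24, 25, 12, 13, 41, 1, 11, 10],
    [0, 4, 3, 37, 38, 16, 17, 18, 19, 20, 21, 22, 23, 24, 14, 13, 41, 40, 39, 2, 1, 11, 12, 25,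
    26, 27, 28, 29, 30, 31, 32, 33, 34, 35, 36, 5, 6, 7, 8, 9, 10],
    [0, 4, 3, 2, 39, 38, 37, 18, 17, 21, 20, 19, 32, 31, 30, 29, 28, 27, 26, 22, 23, 24, 25,
    12, 13, 14, 15, 40, 41, 1, 11, 10, 9, 8, 33, 34, 35, 36, 5, 6, 7],
    [0, 4, 3, 37, 18, 19, 32, 31, 30, 20, 21, 22, 23, 16, 38, 39, 2, 1, 11, 12, 13, 41, 40, 15,
    14, 24, 25, 26, 27, 28, 29, 10, 9, 8, 33, 34, 35, 36, 5, 6, 7],
    [0, 4, 3, 2, 39, 40, 15, 14, 13, 41, 1, 11, 12, 25, 24, 23, 22, 26, 27, 28, 29, 30, 31, 32,
    33, 34, 35, 19, 20, 21, 17, 16, 38, 37, 36, 5, 6, 7, 8, 9, 10],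
    [0, 1, 11, 12, 25, 24, 23, 22, 26, 27, 28, 29, 30, 20, 21, 17, 18, 37, 38, 16, 15, 14, 13,
    41, 40, 39, 2, 3, 4, 5, 36, 35, 34, 6, 7, 8, 33, 32, 31, 9, 10],
    [0, 1, 2, 39, 38, 16, 15, 40, 41, 13, 14, 24, 23, 22, 26, 25, 12, 11, 27, 28, 21, 17, 18,
    19, 32, 33, 34, 35, 36, 37, 3, 4, 5, 6, 7, 8, 9, 31, 30, 29, 10],
    [0, 7, 8, 9, 31, 32, 33, 34, 6, 5, 4, 3, 2, 1, 41, 13, 12, 25, 26, 22, 23, 24, 14, 15, 40,
    39, 38, 16, 17, 18, 37, 36, 35, 19, 20, 30, 29, 28, 27, 11, 10],
    [0, 4, 3, 2, 1, 41, 13, 14, 24, 23, 16, 15, 40, 39, 38, 37, 18, 17, 21, 20, 19, 32, 33, 34,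
    35, 36, 5, 6, 7, 8, 9, 31, 30, 29, 28, 27, 26, 25, 12, 11, 10],
    [0, 4, 3, 37, 38, 39, 2, 1, 11, 12, 25, 24, 14, 13, 41, 40, 15, 16, 17, 18, 19, 20, 21, 22,
    26, 27, 28, 29, 30, 31, 32, 33, 34, 35, 36, 5, 6, 7, 8, 9, 10],
    [0, 1, 41, 13, 14, 15, 40, 39, 2, 3, 4, 5, 6, 7, 8, 9, 31, 32, 33, 34, 35, 36, 37, 38, 16,
    23, 22, 21, 17, 18, 19, 20, 30, 29, 28, 27, 26, 25, 12, 11, 10],
    [0, 1, 11, 12, 13, 41, 40, 39, 2, 3, 4, 5, 36, 35, 19, 20, 21, 17, 18, 37, 38, 16, 15, 14,
    24, 23, 22, 26, 27, 28, 29, 30, 31, 32, 33, 34, 6, 7, 8, 9, 10],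
    [0, 1, 41, 13, 12, 25, 24, 14, 15, 40, 39, 2, 3, 4, 5, 6, 7, 8, 9, 31, 32, 33, 34, 35, 36,
    37, 38, 16, 23, 22, 21, 17, 18, 19, 20, 30, 29, 28, 27, 11, 10],
    [0, 1, 11, 12, 25, 26, 22, 23, 24, 14, 13, 41, 40, 15, 16, 17, 21, 28, 29, 10, 9, 8, 7, 6,
    5, 36, 35, 34, 33, 32, 31, 30, 20, 19, 18, 37, 38, 39, 2, 3, 4],
    [0, 7, 8, 9, 31, 32, 33, 34, 6, 5, 4, 3, 2, 1, 11, 27, 26, 25, 12, 13, 41, 40, 39, 38, 37,
    36, 35, 19, 18, 17, 16, 15, 14, 24, 23, 22, 21, 20, 30, 29, 10],
    [0, 1, 2, 39, 38, 16, 15, 40, 41, 13, 14, 24, 23, 22, 26, 25, 12, 11, 27, 28, 21, 17, 18,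
    19, 20, 30, 31, 32, 33, 34, 35, 36, 37, 3, 4, 5, 6, 7, 8, 9, 10],
    [0, 1, 11, 10, 29, 28, 27, 26, 25, 12, 13, 41, 40, 15, 14, 24, 23, 22, 21, 20, 19, 35, 36,
    37, 18, 17, 16, 38, 39, 2, 3, 4, 5, 6, 34, 33, 32, 31, 9, 8, 7],
    [0, 1, 11, 12, 25, 24, 23, 22, 26, 27, 28, 29, 30, 20, 21, 17, 18, 19, 32, 33, 34, 35, 36,
    37, 38, 16, 15, 14, 13, 41, 40, 39, 2, 3, 4, 5, 6, 7, 8, 9, 10],
    [0, 1, 11, 10, 9, 31, 30, 29, 28, 27, 26, 25, 12, 13, 41, 40, 15, 14, 24, 23, 22, 21, 20,
    19, 35, 36, 37, 18, 17, 16, 38, 39, 2, 3, 4, 5, 6, 34, 33, 8, 7],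
    [0, 1, 11, 12, 25, 24, 23, 22, 26, 27, 28, 29, 30, 31, 32, 19, 20, 21, 17, 18, 37, 38, 16,
    15, 14, 13, 41, 40, 39, 2, 3, 4, 5, 36, 35, 34, 6, 7, 8, 9, 10],
    [0, 1, 11, 10, 9, 8, 33, 32, 31, 30, 29, 28, 27, 26, 25, 12, 13, 41, 40, 15, 14, 24, 23,
    22, 21, 20, 19, 35, 36, 37, 18, 17, 16, 38, 39, 2, 3, 4, 5, 6, 7],
    [0, 7, 6, 34, 33, 8, 9, 31, 32, 19, 18, 17, 16, 15, 14, 24, 23, 22, 21, 20, 30, 29, 28, 27,
    26, 25, 12, 13, 41, 40, 39, 38, 37, 36, 5, 4, 3, 2, 1, 11, 10],
    [0, 1, 11, 12, 25, 24, 23, 22, 26, 27, 28, 29, 10, 9, 8, 33, 34, 35, 19, 32, 31, 30, 20,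
    21, 17, 18, 37, 38, 16, 15, 14, 13, 41, 40, 39, 2, 3, 4, 5, 6, 7],
    [0, 1, 11, 10, 9, 8, 7, 6, 5, 36, 35, 34, 33, 32, 31, 30, 29, 28, 27, 26, 25, 12, 13, 41,
    40, 15, 14, 24, 23, 22, 21, 20, 19, 18, 17, 16, 38, 39, 2, 3, 4],
    [0, 4, 3, 37, 18, 17, 16, 15, 14, 24, 23, 22, 21, 20, 19, 32, 31, 30, 29, 28, 27, 26, 25,
    12, 13, 41, 40, 39, 2, 1, 11, 10, 9, 8, 33, 34, 35, 36, 5, 6, 7],
    [0, 1, 2, 3, 4, 5, 6, 7, 8, 9, 31, 32, 33, 34, 35, 36, 37, 38, 16, 23, 22, 21, 17, 18, 19,
    20, 30, 29, 28, 27, 26, 25, 24, 14, 15, 40, 41, 13, 12, 11, 10],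
    [0, 4, 3, 2, 39, 38, 37, 18, 19, 20, 21, 17, 16, 15, 14, 13, 41, 1, 11, 12, 25, 24, 23, 22,
    26, 27, 28, 29, 30, 31, 32, 33, 34, 35, 36, 5, 6, 7, 8, 9, 10],
    [0, 1, 2, 39, 40, 15, 14, 13, 12, 11, 10, 9, 8, 7, 6, 5, 36, 35, 34, 33, 32, 31, 30, 29,
    28, 27, 26, 25, 24, 23, 22, 21, 20, 19, 18, 17, 16, 38, 37, 3, 4]]"

lemma G42_simps [simp]:
  "verts G42 = {..<42}" "tail G42 = fst" "head G42 = snd"
  "arcs G42 = set end_pairs \<union> prod.swap ` set end_pairs"
  by (simp_all add: G42_def)

lemma end_pairs_bounds: "\<forall>(u, v)\<in>set end_pairs. u < v \<and> v < 42"
  by code_simp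

lemma graph_G42: "graph G42"
proof
  show "finite (verts G42)" "finite (arcs G42)" by auto
  show "tail G42 e \<in> verts G42" "head G42 e \<in> verts G42" "tail G42 e \<noteq> head G42 e"
    if "e \<in> arcs G42" for e
    using that end_pairs_bounds by fastforce+
  show "e = f" if "arc_to_ends G42 e = arc_to_ends G42 f" for e f
    using that by (simp add: arc_to_ends_def prod_eq_iff)
  have "arcs_ends G42 = arcs G42" by (auto simp: arcs_ends_def arc_to_ends_def)
  then show "symmetric G42" by (auto simp: symmetric_def sym_def)
qed

subsection \<open>Planarity\<close>

lemma points_distinct: "distinct points \<and> length points = 42"
  by code_simp

text \<open>The relation is symmetric, so \<open>sorted_wrt\<close> tests every unordered pair of
  edges once.\<close>

lemma segments_cross_free:
  "sorted_wrt (\<lambda>s t. one_sided s t \<or> one_sided t s)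
     (map (\<lambda>(u, v). (points ! u, points ! v)) end_pairs)"
  by code_simp

lemma path_in_end_pairs: "\<forall>i<41. (i, Suc i) \<in> set end_pairs"
  by code_simp

lemma edges_G42: "edges G42 = (\<lambda>(u, v). {u, v}) ` set end_pairs"
  by (force simp: edges_def image_iff)

lemma planar_G42: "planar G42"
proof (rule planar_straight_line[where pt = "\<lambda>v. points ! v", OF edges_G42])
  show "u < v \<and> u \<in> verts G42 \<and> v \<in> verts G42" if "(u, v) \<in> set end_pairs" for u v
    using that end_pairs_bounds by fastforce
  show "verts G42 \<subseteq> \<Union> (edges G42)"
  proof
    fix v assume "v \<in> verts G42"
    \<comment> \<open>Every vertex lies on the Hamiltonian path; vertex 0 has no predecessor there
      and takes the first path edge.\<close>
    then have "(if v = 0 then (0, 1) else (v - 1, v)) \<in> set end_pairs"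
      using path_in_end_pairs[rule_format, of "v - 1"] path_in_end_pairs[rule_format, of 0] by auto
    then show "v \<in> \<Union> (edges G42)" unfolding edges_G42 by (force split: if_splits)
  qed
  show "inj_on ((!) points) (verts G42)"
    using points_distinct by (simp add: inj_on_nth)
  fix u v x y assume *: "(u, v) \<in> set end_pairs" "(x, y) \<in> set end_pairs" "(u, v) \<noteq> (x, y)"
  then obtain i j where ij: "i < length end_pairs" "j < length end_pairs" "i \<noteq> j"
      "end_pairs ! i = (u, v)" "end_pairs ! j = (x, y)"
    by (metis in_set_conv_nth)
  then show "one_sided (points ! u, points ! v) (points ! x, points ! y)
      \<or> one_sided (points ! x, points ! y) (points ! u, points ! v)"
    using sorted_wrt_nth_less[OF segments_cross_free, of i j]
      sorted_wrt_nth_less[OF segments_cross_free, of j i]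
    by (cases i j rule: linorder_cases) auto
qed

subsection \<open>Hypohamiltonicity\<close>

lemma tree_cotree_G42:
  "tree_cotree 42 27 (set map_edges) fst (fst \<circ> snd) (fst \<circ> snd \<circ> snd) (snd \<circ> snd \<circ> snd)
     (\<lambda>v. map_edges ! (v - 1)) (\<lambda>f. map_edges ! (40 + f))"
proof
  have len: "length map_edges = 67" by code_simp
  have "distinct map_edges" by code_simp
  then show "card (set map_edges) + 2 = 42 + 27" using len by (simp add: distinct_card)
  have "{..<67} = (\<lambda>v. v - 1) ` {1..<42} \<union> (\<lambda>f. 40 + f) ` {1..<27::nat}"
  proof (intro equalityI subsetI)
    fix i :: nat assume "i \<in> {..<67}"
    then have "i = Suc i - 1 \<and> Suc i \<in> {1..<42} \<or> i = 40 + (i - 40) \<and> i - 40 \<in> {1..<27}" by auto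
    then show "i \<in> (\<lambda>v. v - 1) ` {1..<42} \<union> (\<lambda>f. 40 + f) ` {1..<27}" by blast
  qed auto
  moreover have "set map_edges = (!) map_edges ` {..<67}"
    using len by (auto simp: set_conv_nth)
  ultimately show "set map_edges = (\<lambda>v. map_edges ! (v - 1)) ` {1..<42} \<union>
      (\<lambda>f. map_edges ! (40 + f)) ` {1..<27}"
    by (simp only: image_Un image_image)
  have "\<forall>e\<in>set map_edges. (case e of (u, v, f, g) \<Rightarrow> u < 42 \<and> v < 42 \<and> f < 27 \<and> g < 27)"
    by code_simp
  then show "fst e < 42 \<and> (fst \<circ> snd) e < 42"
      "(fst \<circ> snd \<circ> snd) e < 27 \<and> (snd \<circ> snd \<circ> snd) e < 27" if "e \<in> set map_edges" for e
    using that by fastforce+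
  have "\<forall>v\<in>set [1..<42]. fst (map_edges ! (v - 1)) < v \<and> (fst \<circ> snd) (map_edges ! (v - 1)) = v"
    by code_simp
  then show "fst (map_edges ! (v - 1)) < v \<and> (fst \<circ> snd) (map_edges ! (v - 1)) = v"
    if "v \<in> {1..<42}" for v
    using that unfolding set_upt by blast
  have "\<forall>f\<in>set [1..<27]. (fst \<circ> snd \<circ> snd) (map_edges ! (40 + f)) < f \<and>
      (snd \<circ> snd \<circ> snd) (map_edges ! (40 + f)) = f"
    by code_simp
  then show "(fst \<circ> snd \<circ> snd) (map_edges ! (40 + f)) < f \<and>
      (snd \<circ> snd \<circ> snd) (map_edges ! (40 + f)) = f"
    if "f \<in> {1..<27}" for f
    using that unfolding set_upt by blast
  \<comment> \<open>Selecting the edges at \<open>v\<close> first lets the loop over the faces run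
    over a short list.\<close>
  have *: "\<forall>v\<in>set [0..<42]. (let es = filter (\<lambda>(u, w, f, g). v = u \<or> v = w) map_edges
      in \<forall>h\<in>set [0..<27]. even (length (filter (\<lambda>(u, w, f, g). (f = h) \<noteq> (g = h)) es)))"
    by code_simp
  fix v h :: nat assume vh: "v < 42" "h < 27"
  define es where "es = filter (\<lambda>(u, w, f, g). (f = h) \<noteq> (g = h))
    (filter (\<lambda>(u, w, f, g). v = u \<or> v = w) map_edges)"
  have "distinct es" using \<open>distinct map_edges\<close> by (simp add: es_def)
  moreover have "even (length es)" using * vh by (simp add: es_def Let_def)
  ultimately have "even (card (set es))" by (simp add: distinct_card)
  also have "set es = {e \<in> set map_edges. (v = fst e \<or> v = (fst \<circ> snd) e) \<and>
      (((fst \<circ> snd \<circ> snd) e = h) \<noteq> ((snd \<circ> snd \<circ> snd) e = h))}"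
    by (auto simp: es_def)
  finally show "even (card {e \<in> set map_edges. (v = fst e \<or> v = (fst \<circ> snd) e) \<and>
      (((fst \<circ> snd \<circ> snd) e = h) \<noteq> ((snd \<circ> snd \<circ> snd) e = h))})" .
qed

lemma not_hamiltonian_G42: "\<not> hamiltonian G42"
proof
  interpret tree_cotree 42 27 "set map_edges" fst "fst \<circ> snd" "fst \<circ> snd \<circ> snd" "snd \<circ> snd \<circ> snd"
      "\<lambda>v. map_edges ! (v - 1)" "\<lambda>f. map_edges ! (40 + f)"
    by (rule tree_cotree_G42)
  assume "hamiltonian G42"
  then obtain p where "set p \<subseteq> arcs G42" "length p \<ge> 3" "distinct (map (tail G42) p)"
      "tail G42 ` set p = verts G42"
      "\<forall>i<length p. head G42 (p ! i) = tail G42 (p ! (Suc i mod length p))"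
    by (rule hamiltonianE)
  note p = this[unfolded G42_simps(1-3)]
  have len: "length p = 42"
    using distinct_card[OF p(3)] p(4) by simp
  define w where "w i = fst (p ! i)" for i
  have "bij_betw ((!) (map fst p)) {..<42} {..<42}"
    using p(3,4) len by (intro bij_betw_nth) auto
  then have w: "bij_betw w {..<42} {..<42}"
    by (rule iffD1[OF bij_betw_cong, rotated]) (simp add: w_def len)
  \<comment> \<open>The cycle may traverse an edge against its stored direction, so only the
    unordered ends are compared.\<close>
  have "\<exists>e\<in>set map_edges. {fst e, (fst \<circ> snd) e} = {w i, w (Suc i mod 42)}" if "i < 42" for i
  proof -
    have "p ! i \<in> arcs G42" using subsetD[OF p(1) nth_mem[of i p]] that len by simp
    moreover have "p ! i = (w i, w (Suc i mod 42))"
      using p(5)[rule_format, of i] that len by (simp add: w_def prod_eq_iff)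
    ultimately obtain e where "e \<in> set map_edges"
        "(w i, w (Suc i mod 42)) = (fst e, fst (snd e)) \<or> (w (Suc i mod 42), w i) = (fst e, fst (snd e))"
      by (auto simp: end_pairs_def)
    then show ?thesis by (intro bexI[of _ e]) auto
  qed
  then obtain c where c: "\<And>i. i < 42 \<Longrightarrow> c i \<in> set map_edges \<and>
      {fst (c i), (fst \<circ> snd) (c i)} = {w i, w (Suc i mod 42)}"
    by metis
  obtain S where S: "S \<subseteq> {..<27}" "(\<Sum>f\<in>S. int (face_length f) - 2) = 40"
    using grinberg_hamiltonian[OF _ w c] by auto
  have *: "\<forall>h\<in>set [0..<27]. length (filter (\<lambda>(u, v, f, g). f = h) map_edges) +
      length (filter (\<lambda>(u, v, f, g). g = h) map_edges) = (if h = 0 then 4 else 5)"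
    by code_simp
  have dist: "distinct map_edges" by code_simp
  have "face_length h = (if h = 0 then 4 else 5)" if "h < 27" for h
  proof -
    have "card {e \<in> set map_edges. P e} = length (filter P map_edges)" for P
      using distinct_card[of "filter P map_edges"] dist by simp
    then show ?thesis
      unfolding face_length_def using bspec[OF *, of h] that by (simp add: case_prod_unfold)
  qed
  then have "(\<Sum>f\<in>S. int (face_length f) - 2) = (\<Sum>f\<in>S. if f = 0 then 2 else 3)"
    using S(1) by (intro sum.cong) auto
  \<comment> \<open>As 3 minus an indicator the sum becomes explicit: \<open>3 * card S\<close>
    would be 40 or 41.\<close>
  also have "\<dots> = (\<Sum>f\<in>S. 3 - (if f = 0 then 1 else 0))"
    by (intro sum.cong) auto
  also have "\<dots> = 3 * int (card S) - (if 0 \<in> S then 1 else 0)"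
    using finite_subset[OF S(1)] by (simp add: sum_subtractf)
  finally show False using S(2) by (auto split: if_splits; presburger)
qed

lemma cycles_check:
  "length cycles = 42 \<and> (\<forall>(v, c)\<in>set (List.enumerate 0 cycles).
     distinct c \<and> length c = 41 \<and> (\<forall>x\<in>set c. x < 42 \<and> x \<noteq> v) \<and>
     (\<forall>(x, y)\<in>set (zip c (rotate1 c)). (x, y) \<in> set end_pairs \<or> (y, x) \<in> set end_pairs))"
  by code_simp

lemma hamiltonian_del_vert_G42:
  assumes v: "v < 42"
  shows "hamiltonian (pre_digraph.del_vert G42 v)"
proof -
  define c where "c = cycles ! v"
  have "(v, c) \<in> set (List.enumerate 0 cycles)"
    using v cycles_check by (auto simp: in_set_enumerate_eq c_def)
  then have c: "distinct c" "length c = 41" "\<forall>x\<in>set c. x < 42 \<and> x \<noteq> v"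
      "\<forall>(x, y)\<in>set (zip c (rotate1 c)). (x, y) \<in> set end_pairs \<or> (y, x) \<in> set end_pairs"
    using cycles_check by blast+
  have "set c \<subseteq> {..<42} - {v}" using c(3) by auto
  moreover have "card (set c) = card ({..<42} - {v})" using c v by (simp add: distinct_card)
  ultimately have set_c: "set c = {..<42} - {v}" by (intro card_subset_eq) auto
  show ?thesis
  proof (rule hamiltonian_pairI)
    show "set (zip c (rotate1 c)) \<subseteq> arcs (pre_digraph.del_vert G42 v)"
    proof
      fix e assume e: "e \<in> set (zip c (rotate1 c))"
      obtain x y where "e = (x, y)" by force
      then have "x \<in> set c" "y \<in> set c"
        using e by (auto dest: set_zip_leftD set_zip_rightD)
      moreover have "e \<in> arcs G42"
        using bspec[OF c(4) e] \<open>e = (x, y)\<close> by simp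
      ultimately show "e \<in> arcs (pre_digraph.del_vert G42 v)"
        using set_c \<open>e = (x, y)\<close> by (auto simp: pre_digraph.del_vert_def)
    qed
  qed (use c set_c in \<open>auto simp: pre_digraph.del_vert_def\<close>)
qed

theorem mainTheorem1:
  shows "\<exists>G :: (nat, nat \<times> nat) pre_digraph.
    graph G \<and> planar G \<and> card (verts G) = 42 \<and> hypohamiltonian G"
proof (intro exI conjI)
  show "graph G42" by (rule graph_G42)
  show "planar G42" by (rule planar_G42)
  show "card (verts G42) = 42" by simp
  show "hypohamiltonian G42"
    unfolding hypohamiltonian_def using not_hamiltonian_G42 hamiltonian_del_vert_G42 by simp
qed

end
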